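(* There is an algorithm which, given a finite set $\mathbf{R}$ of $n$ decision procedures with runtimes $t_1,\dots,t_n$ and qualities $q_1,\dots,q_n$, and an exponential deadline distribution $P_d(t)=1-e^{-\beta t}$ ($t\ge 0$, $\beta>0$), determines an optimal sequence of decision procedures from $\mathbf{R}$ in $O(n^2)$ time.
   Context: A decision procedure (rule) $r$ has an integer runtime $t_r\ge 0$ and a real quality $q_r\ge 0$. A sequence (agent program) is a finite nonempty sequence $s=s_1\ldots s_m$ of elements of the finite set $\mathbf{R}$; its rules are run in order. A deadline occurs at a random nonnegative time with cumulative distribution function $P_d$ and is announced when it arrives; the agent then executes the action of the highest-quality rule completed so far. The value of $s$ is $$V(s)=\sum_{i=1}^{m}\Big[P_d\Big(\sum_{j=1}^{i+1}t_{s_j}\Big)-P_d\Big(\sum_{j=1}^{i}t_{s_j}\Big)\Big]Q_i,\qquad Q_i=\max\{q_{s_1},\dots,q_{s_i}\},$$ where for $i=m$ the term $P_d(\sum_{j=1}^{m+1}t_{s_j})$ is read as $1$. A sequence is optimal if it maximizes $V$ among all sequences over $\mathbf{R}$. Running time counts arithmetic operations and comparisons on real numbers and evaluations of $P_d$ as unit-cost steps. *)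

theory Defs
  imports Complex_Main "HOL-Library.Landau_Symbols"
begin

section \<open>Sequences of decision procedures\<close>

text \<open>
  Sequences are lists and positions count from 0. Entry \<open>i\<close> is completed at time
  \<open>finish_time t s i\<close>, and the best result available from then until the next completion
  has quality \<open>best_quality q s i\<close>.
\<close>

definition finish_time :: "('r \<Rightarrow> nat) \<Rightarrow> 'r list \<Rightarrow> nat \<Rightarrow> nat" where
  "finish_time t s i = (\<Sum>j\<le>i. t (s ! j))"

definition best_quality :: "('r \<Rightarrow> real) \<Rightarrow> 'r list \<Rightarrow> nat \<Rightarrow> real" where
  "best_quality q s i = Max ((\<lambda>j. q (s ! j)) ` {..i})"

definition seq_value :: "(real \<Rightarrow> real) \<Rightarrow> ('r \<Rightarrow> nat) \<Rightarrow> ('r \<Rightarrow> real) \<Rightarrow> 'r list \<Rightarrow> real" where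
  "seq_value P t q s =
     (\<Sum>i<length s.
        ((if Suc i = length s then 1 else P (real (finish_time t s (Suc i))))
          - P (real (finish_time t s i))) * best_quality q s i)"

definition optimal_seq ::
  "(real \<Rightarrow> real) \<Rightarrow> ('r \<Rightarrow> nat) \<Rightarrow> ('r \<Rightarrow> real) \<Rightarrow> 'r set \<Rightarrow> 'r list \<Rightarrow> bool" where
  "optimal_seq P t q R s \<longleftrightarrow> is_arg_max (seq_value P t q) (\<lambda>u. u \<noteq> [] \<and> u \<in> lists R) s"

definition exponential_cdf :: "real \<Rightarrow> real \<Rightarrow> real" where
  "exponential_cdf \<beta> x = (if x < 0 then 0 else 1 - exp (- \<beta> * x))"

section \<open>A unit-cost machine with real numbers\<close>

text \<open>
  The memory consists of arrays of natural numbers, used for indices and counters, and arrays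
  of real numbers; \<open>imem \<sigma> a i\<close> is cell \<open>i\<close> of index array \<open>a\<close>. A program is a fixed finite
  piece of syntax, so it mentions finitely many arrays and is the same for all input sizes.
  There is no conversion from reals to indices, hence no rounding, and numerals are the only
  real constants. The deadline distribution can be evaluated through \<open>RCdf\<close>.
\<close>

record state =
  imem :: "nat \<Rightarrow> nat \<Rightarrow> nat"
  rmem :: "nat \<Rightarrow> nat \<Rightarrow> real"

datatype iexp =
    INum nat
  | IGet nat iexp
  | IAdd iexp iexp
  | ISub iexp iexp

datatype rexp =
    RNum nat
  | RGet nat iexp
  | RAdd rexp rexp
  | RSub rexp rexp
  | RMul rexp rexp
  | RDiv rexp rexp
  | RCdf rexp

datatype bexp =
    ILess iexp iexp
  | RLess rexp rexp
  | BNot bexp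
  | BAnd bexp bexp

datatype com =
    Skip
  | IPut nat iexp iexp
  | RPut nat iexp rexp
  | Seq com com
  | If bexp com com
  | While bexp com

text \<open>
  \<open>ISub\<close> is truncated subtraction, and \<open>RDiv\<close> yields 0 when the divisor is 0.
\<close>

primrec ival :: "iexp \<Rightarrow> state \<Rightarrow> nat" where
  "ival (INum k) \<sigma> = k"
| "ival (IGet a e) \<sigma> = imem \<sigma> a (ival e \<sigma>)"
| "ival (IAdd d e) \<sigma> = ival d \<sigma> + ival e \<sigma>"
| "ival (ISub d e) \<sigma> = ival d \<sigma> - ival e \<sigma>"

primrec rval :: "(real \<Rightarrow> real) \<Rightarrow> rexp \<Rightarrow> state \<Rightarrow> real" where
  "rval P (RNum k) \<sigma> = real k"
| "rval P (RGet a e) \<sigma> = rmem \<sigma> a (ival e \<sigma>)"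
| "rval P (RAdd d e) \<sigma> = rval P d \<sigma> + rval P e \<sigma>"
| "rval P (RSub d e) \<sigma> = rval P d \<sigma> - rval P e \<sigma>"
| "rval P (RMul d e) \<sigma> = rval P d \<sigma> * rval P e \<sigma>"
| "rval P (RDiv d e) \<sigma> = rval P d \<sigma> / rval P e \<sigma>"
| "rval P (RCdf e) \<sigma> = P (rval P e \<sigma>)"

primrec bval :: "(real \<Rightarrow> real) \<Rightarrow> bexp \<Rightarrow> state \<Rightarrow> bool" where
  "bval P (ILess d e) \<sigma> \<longleftrightarrow> ival d \<sigma> < ival e \<sigma>"
| "bval P (RLess d e) \<sigma> \<longleftrightarrow> rval P d \<sigma> < rval P e \<sigma>"
| "bval P (BNot b) \<sigma> \<longleftrightarrow> \<not> bval P b \<sigma>"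
| "bval P (BAnd b c) \<sigma> \<longleftrightarrow> bval P b \<sigma> \<and> bval P c \<sigma>"

text \<open>
  Every node of an expression costs one step, so index arithmetic, memory accesses and control
  flow are charged in addition to real arithmetic, real comparisons and evaluations of the
  distribution.
\<close>

primrec icost :: "iexp \<Rightarrow> nat" where
  "icost (INum k) = 1"
| "icost (IGet a e) = 1 + icost e"
| "icost (IAdd d e) = 1 + icost d + icost e"
| "icost (ISub d e) = 1 + icost d + icost e"

primrec rcost :: "rexp \<Rightarrow> nat" where
  "rcost (RNum k) = 1"
| "rcost (RGet a e) = 1 + icost e"
| "rcost (RAdd d e) = 1 + rcost d + rcost e"
| "rcost (RSub d e) = 1 + rcost d + rcost e"
| "rcost (RMul d e) = 1 + rcost d + rcost e"
| "rcost (RDiv d e) = 1 + rcost d + rcost e"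
| "rcost (RCdf e) = 1 + rcost e"

primrec bcost :: "bexp \<Rightarrow> nat" where
  "bcost (ILess d e) = 1 + icost d + icost e"
| "bcost (RLess d e) = 1 + rcost d + rcost e"
| "bcost (BNot b) = 1 + bcost b"
| "bcost (BAnd b c) = 1 + bcost b + bcost c"

definition iput :: "nat \<Rightarrow> nat \<Rightarrow> nat \<Rightarrow> state \<Rightarrow> state" where
  "iput a i v \<sigma> = \<sigma>\<lparr>imem := (imem \<sigma>)(a := (imem \<sigma> a)(i := v))\<rparr>"

definition rput :: "nat \<Rightarrow> nat \<Rightarrow> real \<Rightarrow> state \<Rightarrow> state" where
  "rput a i v \<sigma> = \<sigma>\<lparr>rmem := (rmem \<sigma>)(a := (rmem \<sigma> a)(i := v))\<rparr>"

text \<open>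
  \<open>exec P c \<sigma> k \<sigma>'\<close>: started in \<open>\<sigma>\<close>, the program \<open>c\<close> halts after exactly \<open>k\<close> steps in \<open>\<sigma>'\<close>.
\<close>

inductive exec :: "(real \<Rightarrow> real) \<Rightarrow> com \<Rightarrow> state \<Rightarrow> nat \<Rightarrow> state \<Rightarrow> bool" for P where
  exec_Skip: "exec P Skip \<sigma> 1 \<sigma>"
| exec_IPut: "exec P (IPut a d e) \<sigma> (1 + icost d + icost e) (iput a (ival d \<sigma>) (ival e \<sigma>) \<sigma>)"
| exec_RPut: "exec P (RPut a d e) \<sigma> (1 + icost d + rcost e) (rput a (ival d \<sigma>) (rval P e \<sigma>) \<sigma>)"
| exec_Seq: "exec P c1 \<sigma>1 k1 \<sigma>2 \<Longrightarrow> exec P c2 \<sigma>2 k2 \<sigma>3 \<Longrightarrow> exec P (Seq c1 c2) \<sigma>1 (k1 + k2) \<sigma>3"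
| exec_IfTrue: "bval P b \<sigma> \<Longrightarrow> exec P c1 \<sigma> k \<sigma>' \<Longrightarrow> exec P (If b c1 c2) \<sigma> (1 + bcost b + k) \<sigma>'"
| exec_IfFalse: "\<not> bval P b \<sigma> \<Longrightarrow> exec P c2 \<sigma> k \<sigma>' \<Longrightarrow> exec P (If b c1 c2) \<sigma> (1 + bcost b + k) \<sigma>'"
| exec_WhileFalse: "\<not> bval P b \<sigma> \<Longrightarrow> exec P (While b c) \<sigma> (1 + bcost b) \<sigma>"
| exec_WhileTrue: "bval P b \<sigma>1 \<Longrightarrow> exec P c \<sigma>1 k1 \<sigma>2 \<Longrightarrow> exec P (While b c) \<sigma>2 k2 \<sigma>3 \<Longrightarrow>
    exec P (While b c) \<sigma>1 (1 + bcost b + k1 + k2) \<sigma>3"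

inductive_cases exec_SkipE: "exec P Skip \<sigma> k \<sigma>'"
inductive_cases exec_IPutE: "exec P (IPut a d e) \<sigma> k \<sigma>'"
inductive_cases exec_RPutE: "exec P (RPut a d e) \<sigma> k \<sigma>'"
inductive_cases exec_SeqE: "exec P (Seq c1 c2) \<sigma> k \<sigma>'"
inductive_cases exec_IfE: "exec P (If b c1 c2) \<sigma> k \<sigma>'"
inductive_cases exec_WhileE: "exec P (While b c) \<sigma> k \<sigma>'"

lemma exec_deterministic:
  "exec P c \<sigma> k \<sigma>1 \<Longrightarrow> exec P c \<sigma> l \<sigma>2 \<Longrightarrow> k = l \<and> \<sigma>1 = \<sigma>2"
proof (induction arbitrary: l \<sigma>2 rule: exec.induct)
  case (exec_Skip \<sigma>)
  then show ?case by (rule exec_SkipE) simp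
next
  case (exec_IPut a d e \<sigma>)
  then show ?case by (rule exec_IPutE) simp
next
  case (exec_RPut a d e \<sigma>)
  then show ?case by (rule exec_RPutE) simp
next
  case (exec_Seq c1 \<sigma>1 k1 \<sigma>' c2 k2 \<sigma>'')
  then obtain m1 \<tau> m2 where *: "l = m1 + m2" "exec P c1 \<sigma>1 m1 \<tau>" "exec P c2 \<tau> m2 \<sigma>2"
    by (blast elim: exec_SeqE)
  with exec_Seq.IH(1) have "k1 = m1" "\<sigma>' = \<tau>" by blast+
  with * exec_Seq.IH(2) show ?case by force
next
  case (exec_IfTrue b \<sigma> c1 k \<sigma>' c2)
  then obtain m where "l = Suc (bcost b + m)" "exec P c1 \<sigma> m \<sigma>2"
    by (blast elim: exec_IfE)
  then show ?case using exec_IfTrue.IH by force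
next
  case (exec_IfFalse b \<sigma> c2 k \<sigma>' c1)
  then obtain m where "l = Suc (bcost b + m)" "exec P c2 \<sigma> m \<sigma>2"
    by (blast elim: exec_IfE)
  then show ?case using exec_IfFalse.IH by force
next
  case (exec_WhileFalse b \<sigma> c)
  from exec_WhileFalse.prems show ?case
    by (rule exec_WhileE) (use exec_WhileFalse.hyps in auto)
next
  case (exec_WhileTrue b \<sigma>1 c k1 \<sigma>' k2 \<sigma>'')
  then obtain m1 \<tau> m2 where *: "l = Suc (bcost b + m1 + m2)"
      "exec P c \<sigma>1 m1 \<tau>" "exec P (While b c) \<tau> m2 \<sigma>2"
    by (blast elim: exec_WhileE)
  with exec_WhileTrue.IH(1) have "k1 = m1" "\<sigma>' = \<tau>" by blast+
  with * exec_WhileTrue.IH(2) show ?case by force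
qed

section \<open>Input and output\<close>

text \<open>
  Input: the number \<open>n\<close> of rules in cell 0 of index array 0; runtimes and qualities in cells
  \<open>0, ..., n - 1\<close> of the real arrays 0 and 1; the rate in cell 0 of real array 2. All other
  cells are 0. Output: the length of the sequence in cell 0 of index array 1, its entries in
  index array 2.
\<close>

definition input_state :: "nat \<Rightarrow> (nat \<Rightarrow> nat) \<Rightarrow> (nat \<Rightarrow> real) \<Rightarrow> real \<Rightarrow> state" where
  "input_state n t q \<beta> =
     \<lparr>imem = (\<lambda>a i. if a = 0 \<and> i = 0 then n else 0),
      rmem = (\<lambda>a i. if a = 0 \<and> i < n then real (t i)
                    else if a = 1 \<and> i < n then q i
                    else if a = 2 \<and> i = 0 then \<beta>
                    else 0)\<rparr>"

definition output_seq :: "state \<Rightarrow> nat list" where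
  "output_seq \<sigma> = map (imem \<sigma> 2) [0..<imem \<sigma> 1 0]"

end

theory Submission
  imports Defs
begin

text \<open>
  Write \<open>x r = exp (- \<beta> * t r)\<close>. Since the exponential distribution is memoryless, summation by
  parts turns the value of a sequence into a recursion: starting with quality \<open>p\<close> available,
  running \<open>r\<close> first contributes the factor \<open>x r\<close>, applied to the improvement over \<open>p\<close> plus the
  gain of the rest. Rules that do not improve the current quality only discount the rest, so the
  best gain from quality \<open>p\<close> depends only on the rules of higher quality. Processing the rules
  by decreasing quality and relaxing all unprocessed ones after each choice gives a dynamic
  program with \<open>n\<close> rounds of linear cost; no prior sorting is needed.
\<close>

section \<open>The value of a sequence as a recursion\<close>

text \<open>With \<open>x r\<close> the probability that the deadline outlasts a run of
  \<open>r\<close>, this is the expected excess over \<open>p\<close> of the quality delivered when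
  \<open>p\<close> is on hand from the outset. Measuring the excess makes stopping worth 0.\<close>

primrec gain :: "('r \<Rightarrow> real) \<Rightarrow> ('r \<Rightarrow> real) \<Rightarrow> real \<Rightarrow> 'r list \<Rightarrow> real" where
  "gain x q p [] = 0"
| "gain x q p (r # u) = x r * (max p (q r) - p + gain x q (max p (q r)) u)"

lemma best_quality_Cons_0: "best_quality q (r # u) 0 = q r"
  by (simp add: best_quality_def)

lemma best_quality_Cons_Suc:
  "best_quality q (r # u) (Suc i) = max (q r) (best_quality q u i)"
proof -
  have "(\<lambda>j. q ((r # u) ! j)) ` {..Suc i} = insert (q r) ((\<lambda>j. q (u ! j)) ` {..i})"
    by (simp only: atMost_Suc_eq_insert_0 image_insert image_image nth_Cons_0 nth_Cons_Suc)
  then show ?thesis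
    by (simp add: best_quality_def)
qed

lemma finish_time_Cons_0: "finish_time t (r # u) 0 = t r"
  by (simp add: finish_time_def)

lemma finish_time_Cons_Suc: "finish_time t (r # u) (Suc i) = t r + finish_time t u i"
  unfolding finish_time_def by (subst sum.atMost_Suc_shift) simp

lemma exponential_cdf_of_nat: "exponential_cdf \<beta> (real k) = 1 - exp (- \<beta> * real k)"
  by (simp add: exponential_cdf_def)

text \<open>Summation by parts, with \<open>p\<close> the quality already available when the sequence starts.\<close>

lemma weighted_sum_eq_gain:
  fixes \<beta> :: real and t :: "'r \<Rightarrow> nat"
  defines "x \<equiv> \<lambda>r. exp (- \<beta> * real (t r))"
  assumes "u \<noteq> []"
  shows "(\<Sum>i<length u. (exp (- \<beta> * real (finish_time t u i))
            - (if Suc i = length u then 0 else exp (- \<beta> * real (finish_time t u (Suc i)))))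
            * max p (best_quality q u i))
         = x (hd u) * p + gain x q p u"
  using assms(2)
proof (induction u arbitrary: p)
  case (Cons r u)
  show ?case
  proof (cases u)
    case Nil
    then show ?thesis
      by (simp add: best_quality_Cons_0 finish_time_Cons_0 x_def algebra_simps)
  next
    case (Cons r' u')
    let ?Q = "max p (q r)"
    let ?f = "\<lambda>u p i. (exp (- \<beta> * real (finish_time t u i))
            - (if Suc i = length u then 0 else exp (- \<beta> * real (finish_time t u (Suc i)))))
            * max p (best_quality q u i)"
    have exp_sum: "exp (- \<beta> * real (t r + k)) = x r * exp (- \<beta> * real k)" for k
      by (simp add: x_def mult_exp_exp ring_distribs)
    \<comment> \<open>Memorylessness: placing \<open>r\<close> in front scales every later weight by
      \<open>x r\<close>, and the quality of \<open>r\<close> joins the available one.\<close>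
    have shift: "?f (r # u) p (Suc i) = x r * ?f u ?Q i" for i
      by (simp add: best_quality_Cons_Suc finish_time_Cons_Suc exp_sum[simplified] max.assoc
          right_diff_distrib)
    have first: "?f (r # u) p 0 = (x r - x r * x r') * ?Q"
      by (simp add: best_quality_Cons_0 finish_time_Cons_0 finish_time_Cons_Suc Cons
          exp_sum[simplified]) (simp add: x_def)
    have "(\<Sum>i<length (r # u). ?f (r # u) p i) = ?f (r # u) p 0 + (\<Sum>i<length u. ?f (r # u) p (Suc i))"
      by (simp only: list.size(4) add_Suc_right add_0_right sum.lessThan_Suc_shift)
    also have "\<dots> = (x r - x r * x r') * ?Q + x r * (\<Sum>i<length u. ?f u ?Q i)"
      by (simp only: shift first sum_distrib_left)
    \<comment> \<open>The part \<open>x r * x r' * ?Q\<close> cancels the negative half of the first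
      term, leaving \<open>x r * ?Q\<close> plus the discounted gain.\<close>
    also have "(\<Sum>i<length u. ?f u ?Q i) = x r' * ?Q + gain x q ?Q u"
      using Cons.IH[of ?Q] Cons by simp
    finally show ?thesis
      by (simp add: algebra_simps)
  qed
qed simp

lemma best_quality_nonneg:
  assumes "\<And>r. r \<in> set u \<Longrightarrow> q r \<ge> 0" "i < length u"
  shows "best_quality q u i \<ge> 0"
proof -
  have "q (u ! 0) \<le> best_quality q u i"
    unfolding best_quality_def by (rule Max_ge) auto
  moreover have "q (u ! 0) \<ge> 0"
    using assms by (intro assms(1) nth_mem) linarith
  ultimately show ?thesis by linarith
qed

text \<open>Increments of the distribution function are decrements of the survival probability, and
  the 1 after the last entry becomes survival probability 0. Non-negative qualities allow the choice
  \<open>p = 0\<close>.\<close>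

lemma seq_value_eq_gain:
  assumes "u \<noteq> []" "\<And>r. r \<in> set u \<Longrightarrow> q r \<ge> 0"
  shows "seq_value (exponential_cdf \<beta>) t q u = gain (\<lambda>r. exp (- \<beta> * real (t r))) q 0 u"
proof -
  have "seq_value (exponential_cdf \<beta>) t q u =
      (\<Sum>i<length u. (exp (- \<beta> * real (finish_time t u i))
            - (if Suc i = length u then 0 else exp (- \<beta> * real (finish_time t u (Suc i)))))
            * max 0 (best_quality q u i))"
    unfolding seq_value_def
  proof (rule sum.cong)
    fix i assume "i \<in> {..<length u}"
    then have "max 0 (best_quality q u i) = best_quality q u i"
      using best_quality_nonneg[of u q i] assms(2) by (simp add: max_def)
    then show "((if Suc i = length u then 1 else exponential_cdf \<beta> (real (finish_time t u (Suc i))))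
        - exponential_cdf \<beta> (real (finish_time t u i))) * best_quality q u i =
      (exp (- \<beta> * real (finish_time t u i))
            - (if Suc i = length u then 0 else exp (- \<beta> * real (finish_time t u (Suc i)))))
            * max 0 (best_quality q u i)"
      by (simp add: exponential_cdf_of_nat)
  qed simp
  then show ?thesis
    using weighted_sum_eq_gain[OF assms(1), of \<beta> t 0 q] by simp
qed

lemma gain_cong:
  assumes "\<And>r. r \<in> set u \<Longrightarrow> x r = x' r" "\<And>r. r \<in> set u \<Longrightarrow> q r = q' r"
  shows "gain x q p u = gain x' q' p u"
  using assms by (induction u arbitrary: p) auto

section \<open>The dynamic program\<close>

text \<open>
  Pointers are shifted by one, so that 0 means that there is no successor.
\<close>

primrec path :: "(nat \<Rightarrow> nat) \<Rightarrow> nat \<Rightarrow> nat list \<Rightarrow> bool" where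
  "path N p [] \<longleftrightarrow> p = 0"
| "path N p (r # s) \<longleftrightarrow> p = Suc r \<and> path N (N r) s"

text \<open>Keeps the chains of processed rules intact while a round redirects the pointers of
  unprocessed entries.\<close>

lemma path_cong:
  assumes "path N p s" "\<And>r. r \<in> set s \<Longrightarrow> N' r = N r"
  shows "path N' p s"
  using assms by (induction s arbitrary: p) auto

text \<open>
  \<open>D\<close> is the set of processed rules; \<open>F j\<close> is the best gain of a sequence of processed rules,
  given the quality of \<open>j\<close>, and \<open>N j\<close> points to the first rule of such a sequence. Index \<open>n\<close>
  stands for the start of the sequence, where quality 0 is available.
\<close>

definition dp_inv ::
  "nat \<Rightarrow> (nat \<Rightarrow> real) \<Rightarrow> (nat \<Rightarrow> real) \<Rightarrow> nat set \<Rightarrow> (nat \<Rightarrow> real) \<Rightarrow> (nat \<Rightarrow> nat) \<Rightarrow> bool" where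
  "dp_inv n x q D F N \<longleftrightarrow>
     D \<subseteq> {..<n} \<and>
     (\<forall>j\<in>D. \<forall>i<n. i \<notin> D \<longrightarrow> q i \<le> q j) \<and>
     (\<forall>j\<le>n. F j \<ge> 0) \<and>
     (\<forall>j\<le>n. \<forall>r\<in>D. q j < q r \<longrightarrow> x r * (q r - q j + F r) \<le> F j) \<and>
     (\<forall>j\<le>n. \<exists>s. path N (N j) s \<and> set s \<subseteq> D \<and> length s \<le> card D \<and> gain x q (q j) s = F j) \<and>
     (D \<noteq> {} \<longrightarrow> N n \<noteq> 0)"

text \<open>Every rule better than \<open>r\<close> is already processed, so \<open>F r\<close> is
  final when it is used. Processed entries are frozen and all others can only grow, which preserves
  the older inequalities.\<close>

lemma dp_inv_step:
  fixes n :: nat and x q F :: "nat \<Rightarrow> real"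
  defines "c \<equiv> \<lambda>r j. x r * (q r - q j + F r)"
  assumes inv: "dp_inv n x q D F N"
    and x: "\<And>r. 0 \<le> x r"
    and q: "\<And>r. 0 \<le> q r" "q n = 0"
    and r: "r < n" "r \<notin> D" "\<And>i. i < n \<Longrightarrow> i \<notin> D \<Longrightarrow> q i \<le> q r"
    and F': "\<And>j. j \<le> n \<Longrightarrow> F' j = (if j \<notin> insert r D \<and> \<not> c r j < F j then c r j else F j)"
    and N': "\<And>j. j \<le> n \<Longrightarrow> N' j = (if j \<notin> insert r D \<and> \<not> c r j < F j then Suc r else N j)"
  shows "dp_inv n x q (insert r D) F' N'"
proof -
  let ?D = "insert r D"
  note inv' = inv[unfolded dp_inv_def]
  have paths: "\<exists>s. path N (N j) s \<and> set s \<subseteq> D \<and> length s \<le> card D \<and> gain x q (q j) s = F j"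
    if "j \<le> n" for j
    using inv' that by (elim conjE allE[of _ j]) simp
  have N_start: "D \<noteq> {} \<Longrightarrow> N n \<noteq> 0"
    using inv' by (elim conjE) simp
  have D: "D \<subseteq> {..<n}" "finite D"
    using inv' finite_subset[of D "{..<n}"] by auto
  have F0: "F j \<ge> 0" if "j \<le> n" for j
    using inv' that by blast
  have F'_ge: "F' j \<ge> F j" if "j \<le> n" for j
    using F'[OF that] by auto
  have F'_D: "F' j = F j" if "j \<in> ?D" for j
    using F'[of j] D that r by auto
  have N'_D: "N' j = N j" if "j \<in> ?D" for j
    using N'[of j] D that r by auto
  \<comment> \<open>The start index \<open>n\<close> behaves like an unprocessed rule of quality
    0.\<close>
  have le: "q j \<le> q r" if "j \<le> n" "j \<notin> ?D" for j
    using that r q by (cases "j = n") auto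
  show ?thesis
    unfolding dp_inv_def
  proof (intro conjI allI impI ballI)
    show "?D \<subseteq> {..<n}"
      using D r by auto
  next
    fix j i assume "j \<in> ?D" "i < n" "i \<notin> ?D"
    then show "q i \<le> q j"
      using inv' r by auto
  next
    fix j assume "j \<le> n"
    then show "0 \<le> F' j"
      using F0[of j] F'_ge[of j] by simp
  next
    fix j r' assume j: "j \<le> n" and r': "r' \<in> ?D" and less: "q j < q r'"
    show "x r' * (q r' - q j + F' r') \<le> F' j"
    proof (cases "r' \<in> D")
      case True
      then have "x r' * (q r' - q j + F r') \<le> F j"
        using inv' j less by blast
      then show ?thesis
        using F'_D[OF r'] F'_ge[OF j] by simp
    next
      case False
      then have "r' = r" using r' by simp
      \<comment> \<open>A processed \<open>j\<close> is at least as good as \<open>r\<close>, so the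
        new inequality concerns only entries that have just been relaxed by
        \<open>r\<close>.\<close>
      have "q r \<le> q j" if "j \<in> D"
        using inv' r that by blast
      then have "j \<notin> ?D"
        using less \<open>r' = r\<close> by force
      then show ?thesis
        using F'_D[OF r'] F'[OF j] \<open>r' = r\<close> by (simp add: c_def)
    qed
  next
    fix j assume j: "j \<le> n"
    have old: "\<exists>s. path N' (N i) s \<and> set s \<subseteq> D \<and> length s \<le> card D \<and> gain x q (q i) s = F i"
      if "i \<le> n" for i
    proof -
      obtain s where s: "path N (N i) s" "set s \<subseteq> D" "length s \<le> card D" "gain x q (q i) s = F i"
        using paths[OF \<open>i \<le> n\<close>] by blast
      moreover have "path N' (N i) s"
        using s(1) by (rule path_cong) (use s(2) N'_D in auto)
      ultimately show ?thesis by blast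
    qed
    show "\<exists>s. path N' (N' j) s \<and> set s \<subseteq> ?D \<and> length s \<le> card ?D \<and> gain x q (q j) s = F' j"
    proof (cases "j \<notin> ?D \<and> \<not> c r j < F j")
      case True
      \<comment> \<open>Prepending \<open>r\<close> to the witness for \<open>r\<close> gives the
        witness for a relaxed \<open>j\<close>, since \<open>r\<close> is at least as good as
        \<open>j\<close>.\<close>
      obtain s where "path N' (N r) s" "set s \<subseteq> D" "length s \<le> card D" "gain x q (q r) s = F r"
        using old[of r] r by auto
      moreover have "max (q j) (q r) = q r"
        using le[OF j] True by simp
      ultimately show ?thesis
        using F'[OF j] N'[OF j] True r D N'_D[of r]
        by (intro exI[of _ "r # s"]) (auto simp: c_def)
    next
      case False
      then have "F' j = F j" "N' j = N j"
        using F'[OF j] N'[OF j] by auto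
      then show ?thesis
        using old[OF j] r(2) D(2) by (metis card_insert_disjoint le_Suc_eq subset_insertI2)
    qed
  next
    \<comment> \<open>The start pointer stays put only if \<open>F n\<close> exceeds a non-negative
      candidate, which is impossible before the first round. Relaxing on ties matters here: it sets
      the pointer even when all gains are 0.\<close>
    have "N n \<noteq> 0" if less: "c r n < F n"
    proof -
      have "D \<noteq> {}"
      proof
        assume "D = {}"
        then have "F n = 0"
          using paths[of n] by auto
        moreover have "c r n \<ge> 0"
          using x q F0[of r] r(1) by (simp add: c_def)
        ultimately show False using less by simp
      qed
      then show ?thesis by (rule N_start)
    qed
    moreover have "n \<notin> ?D"
      using D r by auto
    ultimately show "N' n \<noteq> 0"
      using N'[of n] by simp
  qed
qed

text \<open>\<open>F\<close> is a potential: an improving rule is bounded by the local inequality,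
  and any other rule merely discounts a non-negative bound by a factor of at most 1. Thus sequences
  of any length, with repetitions, are covered.\<close>

lemma gain_le_of_potential:
  fixes n :: nat
  assumes x: "\<And>r. 0 \<le> x r" "\<And>r. x r \<le> 1"
    and F: "\<And>j. j \<le> n \<Longrightarrow> F j \<ge> 0"
    and step: "\<And>j r. j \<le> n \<Longrightarrow> r < n \<Longrightarrow> q j < q r \<Longrightarrow> x r * (q r - q j + F r) \<le> F j"
    and "j \<le> n" "set u \<subseteq> {..<n}"
  shows "gain x q (q j) u \<le> (F j :: real)"
  using assms(5,6)
proof (induction u arbitrary: j)
  case (Cons r u)
  show ?case
  proof (cases "q j < q r")
    case True
    have "gain x q (q r) u \<le> F r"
      using Cons.prems(2) by (intro Cons.IH) auto
    then have "x r * (q r - q j + gain x q (q r) u) \<le> x r * (q r - q j + F r)"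
      by (intro mult_left_mono add_left_mono x)
    also have "\<dots> \<le> F j"
      using Cons.prems True by (intro step) auto
    finally show ?thesis using True by (simp add: max_def)
  next
    case False
    have "x r * gain x q (q j) u \<le> x r * F j"
      using Cons x by (intro mult_left_mono) auto
    also have "\<dots> \<le> F j"
      using F[OF Cons.prems(1)] x by (intro mult_left_le_one_le) auto
    finally show ?thesis using False by (simp add: max_def)
  qed
qed (use F in auto)

text \<open>Once all rules are processed, the potential bounds every sequence, and the pointer chain
  from \<open>n\<close> attains the bound.\<close>

lemma dp_inv_optimal:
  assumes inv: "dp_inv n x q {..<n} F N" and "n \<ge> 1"
    and x: "\<And>r. 0 \<le> x r" "\<And>r. x r \<le> 1" and "q n = 0"
  obtains s where "path N (N n) s" "s \<noteq> []" "set s \<subseteq> {..<n}" "length s \<le> n"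
    "\<And>u. set u \<subseteq> {..<n} \<Longrightarrow> gain x q 0 u \<le> gain x q 0 s"
proof -
  note inv' = inv[unfolded dp_inv_def]
  obtain s where s: "path N (N n) s" "set s \<subseteq> {..<n}" "length s \<le> card {..<n}" "gain x q (q n) s = F n"
    using inv' by blast
  have "s \<noteq> []"
    using s(1) inv' \<open>n \<ge> 1\<close> by (auto simp: lessThan_empty_iff)
  moreover have "gain x q (q n) u \<le> F n" if "set u \<subseteq> {..<n}" for u
    by (rule gain_le_of_potential[OF x _ _ order_refl that]) (use inv' in blast)+
  ultimately show ?thesis
    using that[of s] s \<open>q n = 0\<close> by simp
qed

section \<open>Cost-bounded execution\<close>

text \<open>Total correctness within a budget. An upper bound, not an exact cost, lets branches of
  different cost share one statement.\<close>

definition runs :: "(real \<Rightarrow> real) \<Rightarrow> com \<Rightarrow> state \<Rightarrow> nat \<Rightarrow> (state \<Rightarrow> bool) \<Rightarrow> bool" where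
  "runs P c \<sigma> K Q \<longleftrightarrow> (\<exists>k \<sigma>'. exec P c \<sigma> k \<sigma>' \<and> k \<le> K \<and> Q \<sigma>')"

lemma runs_mono:
  assumes "runs P c \<sigma> K Q" "K \<le> L" "\<And>\<sigma>'. Q \<sigma>' \<Longrightarrow> R \<sigma>'"
  shows "runs P c \<sigma> L R"
  using assms unfolding runs_def by (meson order_trans)

lemma runs_weaken: "runs P c \<sigma> K Q \<Longrightarrow> K \<le> L \<Longrightarrow> runs P c \<sigma> L Q"
  using runs_mono by blast

lemma runs_Skip: "Q \<sigma> \<Longrightarrow> runs P Skip \<sigma> 1 Q"
  unfolding runs_def using exec_Skip by blast

lemma runs_IPut:
  "Q (iput a (ival d \<sigma>) (ival e \<sigma>) \<sigma>) \<Longrightarrow> runs P (IPut a d e) \<sigma> (1 + icost d + icost e) Q"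
  unfolding runs_def using exec_IPut by blast

lemma runs_RPut:
  "Q (rput a (ival d \<sigma>) (rval P e \<sigma>) \<sigma>) \<Longrightarrow> runs P (RPut a d e) \<sigma> (1 + icost d + rcost e) Q"
  unfolding runs_def using exec_RPut by blast

lemma runs_Seq:
  assumes "runs P c1 \<sigma> K1 (\<lambda>\<sigma>'. runs P c2 \<sigma>' K2 Q)"
  shows "runs P (Seq c1 c2) \<sigma> (K1 + K2) Q"
  using assms unfolding runs_def by (meson add_mono exec_Seq)

lemma runs_If:
  assumes "bval P b \<sigma> \<Longrightarrow> runs P c1 \<sigma> K1 Q" "\<not> bval P b \<sigma> \<Longrightarrow> runs P c2 \<sigma> K2 Q"
  shows "runs P (If b c1 c2) \<sigma> (1 + bcost b + max K1 K2) Q"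
proof (cases "bval P b \<sigma>")
  case True
  then obtain k \<sigma>' where "exec P c1 \<sigma> k \<sigma>'" "k \<le> K1" "Q \<sigma>'"
    using assms(1) unfolding runs_def by blast
  then show ?thesis
    unfolding runs_def using exec_IfTrue[OF True] by (intro exI conjI) auto
next
  case False
  then obtain k \<sigma>' where "exec P c2 \<sigma> k \<sigma>'" "k \<le> K2" "Q \<sigma>'"
    using assms(2) unfolding runs_def by blast
  then show ?thesis
    unfolding runs_def using exec_IfFalse[OF False] by (intro exI conjI) auto
qed

text \<open>Meant for loop-free code. A reachable loop yields \<open>False\<close>, so the cost 0
  that \<open>ccost\<close> gives to loops is never claimed for one that is executed.\<close>

primrec wp :: "(real \<Rightarrow> real) \<Rightarrow> com \<Rightarrow> (state \<Rightarrow> bool) \<Rightarrow> state \<Rightarrow> bool" where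
  "wp P Skip Q \<sigma> \<longleftrightarrow> Q \<sigma>"
| "wp P (IPut a d e) Q \<sigma> \<longleftrightarrow> Q (iput a (ival d \<sigma>) (ival e \<sigma>) \<sigma>)"
| "wp P (RPut a d e) Q \<sigma> \<longleftrightarrow> Q (rput a (ival d \<sigma>) (rval P e \<sigma>) \<sigma>)"
| "wp P (Seq c1 c2) Q \<sigma> \<longleftrightarrow> wp P c1 (wp P c2 Q) \<sigma>"
| "wp P (If b c1 c2) Q \<sigma> \<longleftrightarrow> (if bval P b \<sigma> then wp P c1 Q \<sigma> else wp P c2 Q \<sigma>)"
| "wp P (While b c) Q \<sigma> \<longleftrightarrow> False"

primrec ccost :: "com \<Rightarrow> nat" where
  "ccost Skip = 1"
| "ccost (IPut a d e) = 1 + icost d + icost e"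
| "ccost (RPut a d e) = 1 + icost d + rcost e"
| "ccost (Seq c1 c2) = ccost c1 + ccost c2"
| "ccost (If b c1 c2) = 1 + bcost b + max (ccost c1) (ccost c2)"
| "ccost (While b c) = 0"

lemma runs_wp: "wp P c Q \<sigma> \<Longrightarrow> runs P c \<sigma> (ccost c) Q"
proof (induction c arbitrary: Q \<sigma>)
  case (Seq c1 c2)
  then have "runs P c1 \<sigma> (ccost c1) (wp P c2 Q)" by simp
  then have "runs P c1 \<sigma> (ccost c1) (\<lambda>\<sigma>'. runs P c2 \<sigma>' (ccost c2) Q)"
    by (rule runs_mono) (use Seq.IH in auto)
  then show ?case by (simp add: runs_Seq)
next
  case (If b c1 c2)
  then show ?case
    unfolding ccost.simps by (intro runs_If) auto
next
  case (IPut a d e)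
  then show ?case unfolding ccost.simps by (intro runs_IPut) simp
next
  case (RPut a d e)
  then show ?case unfolding ccost.simps by (intro runs_RPut) simp
qed (simp_all add: runs_Skip[simplified])

lemma runs_of_wp: "wp P c Q \<sigma> \<Longrightarrow> ccost c \<le> K \<Longrightarrow> runs P c \<sigma> K Q"
  by (rule runs_weaken[OF runs_wp])

text \<open>The iteration count \<open>m\<close> is known in advance and indexes the invariant; the
  extra \<open>1 + bcost b\<close> pays for the failing test.\<close>

lemma runs_While:
  assumes "I 0 \<sigma>"
    and "\<And>j \<sigma>. j < m \<Longrightarrow> I j \<sigma> \<Longrightarrow> bval P b \<sigma>"
    and "\<And>j \<sigma>. j < m \<Longrightarrow> I j \<sigma> \<Longrightarrow> runs P c \<sigma> K (I (Suc j))"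
    and "\<And>\<sigma>. I m \<sigma> \<Longrightarrow> \<not> bval P b \<sigma>"
  shows "runs P (While b c) \<sigma> (m * (1 + bcost b + K) + (1 + bcost b)) (I m)"
proof -
  have "runs P (While b c) \<sigma> ((m - j) * (1 + bcost b + K) + (1 + bcost b)) (I m)"
    if "j \<le> m" "I j \<sigma>" for j \<sigma>
    using that
  proof (induction "m - j" arbitrary: j \<sigma>)
    case 0
    then have "I m \<sigma>" "\<not> bval P b \<sigma>" using assms(4) by auto
    then show ?case
      using 0 exec_WhileFalse[of P b \<sigma> c] unfolding runs_def by auto
  next
    case (Suc d)
    then have "j < m" by simp
    obtain k \<sigma>' where body: "exec P c \<sigma> k \<sigma>'" "k \<le> K" "I (Suc j) \<sigma>'"
      using assms(3)[OF \<open>j < m\<close> Suc.prems(2)] unfolding runs_def by blast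
    obtain l \<sigma>'' where rest: "exec P (While b c) \<sigma>' l \<sigma>''" "I m \<sigma>''"
      "l \<le> (m - Suc j) * (1 + bcost b + K) + (1 + bcost b)"
      using Suc.hyps(1)[of "Suc j" \<sigma>'] Suc.hyps(2) \<open>j < m\<close> body(3) unfolding runs_def by force
    have "exec P (While b c) \<sigma> (1 + bcost b + k + l) \<sigma>''"
      using assms(2)[OF \<open>j < m\<close> Suc.prems(2)] body(1) rest(1) by (rule exec_WhileTrue)
    moreover have "m - j = Suc (m - Suc j)" using \<open>j < m\<close> by simp
    then have "1 + bcost b + k + l \<le> (m - j) * (1 + bcost b + K) + (1 + bcost b)"
      using body(2) rest(3) by simp
    ultimately show ?case
      using rest(2) unfolding runs_def by blast
  qed
  from this[of 0 \<sigma>] assms(1) show ?thesis by simp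
qed

lemma imem_iput: "imem (iput a i v \<sigma>) b = (if b = a then (imem \<sigma> a)(i := v) else imem \<sigma> b)"
  by (simp add: iput_def)

lemma rmem_iput: "rmem (iput a i v \<sigma>) = rmem \<sigma>"
  by (simp add: iput_def)

lemma imem_rput: "imem (rput a i v \<sigma>) = imem \<sigma>"
  by (simp add: rput_def)

lemma rmem_rput: "rmem (rput a i v \<sigma>) b = (if b = a then (rmem \<sigma> a)(i := v) else rmem \<sigma> b)"
  by (simp add: rput_def)

lemmas mem_simps = imem_iput rmem_iput imem_rput rmem_rput

section \<open>The program\<close>

text \<open>
  Index arrays: 3 marks the processed rules, 4 holds the successor pointers, cell 0 of 5 counts
  the rounds, cell 0 of 6 is the counter of the inner loops and cell 0 of 7 the current rule.
  Real array 3 holds the gains.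
\<close>

abbreviation var :: "nat \<Rightarrow> iexp" where
  "var a \<equiv> IGet a (INum 0)"

abbreviation assign :: "nat \<Rightarrow> iexp \<Rightarrow> com" where
  "assign a e \<equiv> IPut a (INum 0) e"

abbreviation incr :: "nat \<Rightarrow> com" where
  "incr a \<equiv> assign a (IAdd (var a) (INum 1))"

text \<open>
  The current rule starts as \<open>n\<close>, whose quality cell is 0, so that the first unprocessed rule
  replaces it.
\<close>

definition select_loop :: com where
  "select_loop =
     While (ILess (var 6) (var 0))
       (Seq (If (BAnd (ILess (IGet 3 (var 6)) (INum 1))
                      (BNot (RLess (RGet 1 (var 6)) (RGet 1 (var 7)))))
                (assign 7 (var 6)) Skip)
            (incr 6))"

text \<open>The first factor is the survival probability \<open>x r\<close> of the current rule, so
  one evaluation of the distribution replaces the exponential.\<close>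

definition candidate :: rexp where
  "candidate = RMul (RSub (RNum 1) (RCdf (RGet 0 (var 7))))
     (RAdd (RSub (RGet 1 (var 7)) (RGet 1 (var 6))) (RGet 3 (var 7)))"

text \<open>The guard admits the counter value \<open>n\<close>, because the start entry is relaxed
  too.\<close>

definition relax_loop :: com where
  "relax_loop =
     While (BNot (ILess (var 0) (var 6)))
       (Seq (If (BAnd (ILess (IGet 3 (var 6)) (INum 1))
                      (BNot (RLess candidate (RGet 3 (var 6)))))
                (Seq (RPut 3 (var 6) candidate) (IPut 4 (var 6) (IAdd (var 7) (INum 1)))) Skip)
            (incr 6))"

definition round_body :: com where
  "round_body =
     Seq (assign 7 (var 0)) (Seq (assign 6 (INum 0)) (Seq select_loop
    (Seq (IPut 3 (var 7) (INum 1)) (Seq (assign 6 (INum 0)) (Seq relax_loop (incr 5))))))"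

text \<open>Cell 0 of array 7 now holds a shifted pointer instead of a rule, hence the subtractions
  of 1.\<close>

definition output_loop :: com where
  "output_loop =
     While (ILess (INum 0) (var 7))
       (Seq (IPut 2 (var 1) (ISub (var 7) (INum 1)))
       (Seq (incr 1) (assign 7 (IGet 4 (ISub (var 7) (INum 1))))))"

definition program :: com where
  "program = Seq (While (ILess (var 5) (var 0)) round_body)
     (Seq (assign 7 (IGet 4 (var 0))) output_loop)"

section \<open>Correctness and running time of the loops\<close>

lemma runs_select_loop:
  assumes "imem \<sigma> 6 0 = 0" "imem \<sigma> 7 0 = n" "imem \<sigma> 0 0 = n"
    and q: "rmem \<sigma> 1 n = 0" "\<And>j. rmem \<sigma> 1 j \<ge> 0"
    and ex: "i < n" "imem \<sigma> 3 i = 0"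
  shows "runs P select_loop \<sigma> (n * 60 + 60) (\<lambda>\<sigma>'. rmem \<sigma>' = rmem \<sigma> \<and>
    (\<forall>a. a \<noteq> 6 \<and> a \<noteq> 7 \<longrightarrow> imem \<sigma>' a = imem \<sigma> a) \<and>
    (let r = imem \<sigma>' 7 0 in r < n \<and> imem \<sigma> 3 r = 0 \<and>
      (\<forall>j<n. imem \<sigma> 3 j = 0 \<longrightarrow> rmem \<sigma> 1 j \<le> rmem \<sigma> 1 r)))"
proof -
  \<comment> \<open>Until an unprocessed rule is seen, the current index is the dummy
    \<open>n\<close>. Its quality 0 together with the non-strict test makes the first such rule
    replace it.\<close>
  define I where "I m (\<sigma>' :: state) \<longleftrightarrow> rmem \<sigma>' = rmem \<sigma> \<and>
    (\<forall>a. a \<noteq> 6 \<and> a \<noteq> 7 \<longrightarrow> imem \<sigma>' a = imem \<sigma> a) \<and> imem \<sigma>' 6 0 = m \<and>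
    (\<forall>j<m. imem \<sigma> 3 j = 0 \<longrightarrow> rmem \<sigma> 1 j \<le> rmem \<sigma> 1 (imem \<sigma>' 7 0)) \<and>
    (if imem \<sigma>' 7 0 < n then imem \<sigma> 3 (imem \<sigma>' 7 0) = 0
     else imem \<sigma>' 7 0 = n \<and> (\<forall>j<m. imem \<sigma> 3 j \<noteq> 0))" for m \<sigma>'
  show ?thesis
    unfolding select_loop_def
  \<comment> \<open>The body costs at most 25 steps and each test 6; the budgets are rounded up here
    and in the other loops.\<close>
  proof (rule runs_mono[OF runs_While[where I = I and m = n and K = 36]])
    show "I 0 \<sigma>"
      using assms by (simp add: I_def)
  next
    fix j \<sigma>' assume j: "j < n" and I: "I j \<sigma>'"
    show "bval P (ILess (var 6) (var 0)) \<sigma>'"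
      using j I assms by (simp add: I_def)
    show "runs P (Seq (If (BAnd (ILess (IGet 3 (var 6)) (INum 1))
                      (BNot (RLess (RGet 1 (var 6)) (RGet 1 (var 7)))))
                (assign 7 (var 6)) Skip)
            (incr 6)) \<sigma>' 36 (I (Suc j))"
      using j I assms(1-4) q(2)[of j]
      by (intro runs_of_wp) (auto simp: I_def mem_simps less_Suc_eq)
  next
    fix \<sigma>' assume "I n \<sigma>'"
    then show "\<not> bval P (ILess (var 6) (var 0)) \<sigma>'"
      using assms by (simp add: I_def)
  next
    fix \<sigma>' assume "I n \<sigma>'"
    then show "rmem \<sigma>' = rmem \<sigma> \<and>
    (\<forall>a. a \<noteq> 6 \<and> a \<noteq> 7 \<longrightarrow> imem \<sigma>' a = imem \<sigma> a) \<and>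
    (let r = imem \<sigma>' 7 0 in r < n \<and> imem \<sigma> 3 r = 0 \<and>
      (\<forall>j<n. imem \<sigma> 3 j = 0 \<longrightarrow> rmem \<sigma> 1 j \<le> rmem \<sigma> 1 r))"
      using ex by (auto simp: I_def Let_def split: if_splits)
  qed simp
qed

text \<open>The result can be stated in terms of the initial state: the marked entry
  \<open>r\<close> is never rewritten, and entry \<open>j\<close> is first touched in iteration
  \<open>j\<close>.\<close>

lemma runs_relax_loop:
  fixes \<sigma> :: state and P :: "real \<Rightarrow> real"
  defines "c \<equiv> \<lambda>r j. (1 - P (rmem \<sigma> 0 r)) * (rmem \<sigma> 1 r - rmem \<sigma> 1 j + rmem \<sigma> 3 r)"
  assumes "imem \<sigma> 6 0 = 0" "imem \<sigma> 7 0 = r" "imem \<sigma> 0 0 = n" "imem \<sigma> 3 r \<noteq> 0"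
  shows "runs P relax_loop \<sigma> (n * 120 + 180) (\<lambda>\<sigma>'.
    (\<forall>a. a \<noteq> 4 \<and> a \<noteq> 6 \<longrightarrow> imem \<sigma>' a = imem \<sigma> a) \<and> (\<forall>b. b \<noteq> 3 \<longrightarrow> rmem \<sigma>' b = rmem \<sigma> b) \<and>
    (\<forall>j\<le>n. rmem \<sigma>' 3 j =
      (if imem \<sigma> 3 j = 0 \<and> \<not> c r j < rmem \<sigma> 3 j then c r j else rmem \<sigma> 3 j)) \<and>
    (\<forall>j\<le>n. imem \<sigma>' 4 j =
      (if imem \<sigma> 3 j = 0 \<and> \<not> c r j < rmem \<sigma> 3 j then Suc r else imem \<sigma> 4 j)))"
proof -
  define I where "I m (\<sigma>' :: state) \<longleftrightarrow>
    (\<forall>a. a \<noteq> 4 \<and> a \<noteq> 6 \<longrightarrow> imem \<sigma>' a = imem \<sigma> a) \<and> (\<forall>b. b \<noteq> 3 \<longrightarrow> rmem \<sigma>' b = rmem \<sigma> b) \<and>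
    imem \<sigma>' 6 0 = m \<and>
    (\<forall>j. rmem \<sigma>' 3 j =
      (if j < m \<and> imem \<sigma> 3 j = 0 \<and> \<not> c r j < rmem \<sigma> 3 j then c r j else rmem \<sigma> 3 j)) \<and>
    (\<forall>j. imem \<sigma>' 4 j =
      (if j < m \<and> imem \<sigma> 3 j = 0 \<and> \<not> c r j < rmem \<sigma> 3 j then Suc r else imem \<sigma> 4 j))" for m \<sigma>'
  show ?thesis
    unfolding relax_loop_def
  proof (rule runs_mono[OF runs_While[where I = I and m = "Suc n" and K = 100]])
    show "I 0 \<sigma>"
      using assms by (simp add: I_def)
  next
    fix j \<sigma>' assume j: "j < Suc n" and I: "I j \<sigma>'"
    show "bval P (BNot (ILess (var 0) (var 6))) \<sigma>'"
      using j I assms by (simp add: I_def)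
    have cand: "rval P candidate \<sigma>' = c r j"
      using I assms by (simp add: I_def candidate_def)
    have [simp]: "rcost candidate = 18"
      by (simp add: candidate_def)
    show "runs P (Seq (If (BAnd (ILess (IGet 3 (var 6)) (INum 1))
                      (BNot (RLess candidate (RGet 3 (var 6)))))
                (Seq (RPut 3 (var 6) candidate) (IPut 4 (var 6) (IAdd (var 7) (INum 1)))) Skip)
            (incr 6)) \<sigma>' 100 (I (Suc j))"
      using I assms(2-5) cand
      by (intro runs_of_wp) (auto simp: I_def mem_simps less_Suc_eq)
  next
    fix \<sigma>' assume "I (Suc n) \<sigma>'"
    then show "\<not> bval P (BNot (ILess (var 0) (var 6))) \<sigma>'"
      using assms by (simp add: I_def)
  qed (auto simp: I_def less_Suc_eq_le)
qed

definition round_inv ::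
  "(real \<Rightarrow> real) \<Rightarrow> nat \<Rightarrow> (nat \<Rightarrow> real) \<Rightarrow> (nat \<Rightarrow> real) \<Rightarrow> nat \<Rightarrow> state \<Rightarrow> bool" where
  "round_inv P n t q k \<sigma> \<longleftrightarrow>
     imem \<sigma> 0 0 = n \<and> imem \<sigma> 1 0 = 0 \<and> imem \<sigma> 5 0 = k \<and> rmem \<sigma> 0 = t \<and> rmem \<sigma> 1 = q \<and>
     card {j. imem \<sigma> 3 j \<noteq> 0} = k \<and>
     dp_inv n (\<lambda>r. 1 - P (t r)) q {j. imem \<sigma> 3 j \<noteq> 0} (rmem \<sigma> 3) (imem \<sigma> 4)"

lemma runs_round_body:
  fixes P :: "real \<Rightarrow> real" and t q :: "nat \<Rightarrow> real" and n :: nat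
  defines "J \<equiv> round_inv P n t q"
  assumes "k < n" "J k \<sigma>" and P: "\<And>r. P (t r) \<le> 1" and q: "\<And>r. 0 \<le> q r" "q n = 0"
  shows "runs P round_body \<sigma> (n * 180 + 300) (J (Suc k))"
proof -
  let ?D = "\<lambda>\<sigma>. {j. imem \<sigma> 3 j \<noteq> 0}"
  let ?\<sigma>0 = "iput 6 0 0 (iput 7 0 n \<sigma>)"
  have J: "imem \<sigma> 0 0 = n" "imem \<sigma> 1 0 = 0" "imem \<sigma> 5 0 = k" "rmem \<sigma> 0 = t" "rmem \<sigma> 1 = q"
    "card (?D \<sigma>) = k" and inv: "dp_inv n (\<lambda>r. 1 - P (t r)) q (?D \<sigma>) (rmem \<sigma> 3) (imem \<sigma> 4)"
    using assms(3) by (auto simp: J_def round_inv_def)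
  have "?D \<sigma> \<subseteq> {..<n}"
    using inv by (simp add: dp_inv_def)
  then have fin: "finite (?D \<sigma>)"
    using finite_subset by blast
  \<comment> \<open>Only \<open>k < n\<close> rules are marked, so some rule is left to
    select.\<close>
  obtain i where i: "i < n" "imem \<sigma> 3 i = 0"
  proof -
    have "\<not> {..<n} \<subseteq> ?D \<sigma>"
      using card_mono[OF fin, of "{..<n}"] J(6) \<open>k < n\<close> by auto
    then show ?thesis using that by auto
  qed
  \<comment> \<open>The budgets 4, 3 and 6 are the exact costs of the three assignments. Marking
    precedes relaxing, so the gain of \<open>r\<close> stays fixed.\<close>
  have relax: "runs P (Seq (IPut 3 (var 7) (INum 1)) (Seq (assign 6 (INum 0)) (Seq relax_loop (incr 5))))
      \<sigma>1 (4 + (3 + ((n * 120 + 180) + 6))) (J (Suc k))"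
    if s1: "rmem \<sigma>1 = rmem \<sigma>" "\<And>a. a \<noteq> 6 \<Longrightarrow> a \<noteq> 7 \<Longrightarrow> imem \<sigma>1 a = imem \<sigma> a"
      and r: "imem \<sigma>1 7 0 = r" "r < n" "imem \<sigma> 3 r = 0"
        "\<And>j. j < n \<Longrightarrow> imem \<sigma> 3 j = 0 \<Longrightarrow> q j \<le> q r" for \<sigma>1 r
  proof -
    let ?\<sigma>2 = "iput 6 0 0 (iput 3 r 1 \<sigma>1)"
    have "runs P (Seq relax_loop (incr 5)) ?\<sigma>2 ((n * 120 + 180) + 6) (J (Suc k))"
    proof (rule runs_Seq, rule runs_mono[OF runs_relax_loop order_refl])
      show "imem ?\<sigma>2 6 0 = 0" "imem ?\<sigma>2 7 0 = r" "imem ?\<sigma>2 0 0 = n" "imem ?\<sigma>2 3 r \<noteq> 0"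
        using s1 r J by (simp_all add: mem_simps)
      let ?c = "\<lambda>r j. (1 - P (rmem ?\<sigma>2 0 r)) * (rmem ?\<sigma>2 1 r - rmem ?\<sigma>2 1 j + rmem ?\<sigma>2 3 r)"
      fix \<sigma>3 :: state
      assume *: "(\<forall>a. a \<noteq> 4 \<and> a \<noteq> 6 \<longrightarrow> imem \<sigma>3 a = imem ?\<sigma>2 a) \<and>
        (\<forall>b. b \<noteq> 3 \<longrightarrow> rmem \<sigma>3 b = rmem ?\<sigma>2 b) \<and>
        (\<forall>j\<le>n. rmem \<sigma>3 3 j =
          (if imem ?\<sigma>2 3 j = 0 \<and> \<not> ?c r j < rmem ?\<sigma>2 3 j then ?c r j else rmem ?\<sigma>2 3 j)) \<and>
        (\<forall>j\<le>n. imem \<sigma>3 4 j =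
          (if imem ?\<sigma>2 3 j = 0 \<and> \<not> ?c r j < rmem ?\<sigma>2 3 j then Suc r else imem ?\<sigma>2 4 j))"
      have D: "?D \<sigma>3 = insert r (?D \<sigma>)"
        using * s1 by (auto simp: mem_simps)
      have "dp_inv n (\<lambda>r. 1 - P (t r)) q (insert r (?D \<sigma>)) (rmem \<sigma>3 3) (imem \<sigma>3 4)"
      proof (rule dp_inv_step[OF inv])
        fix j assume "j \<le> n"
        then show "rmem \<sigma>3 3 j = (if j \<notin> insert r (?D \<sigma>) \<and>
            \<not> (1 - P (t r)) * (q r - q j + rmem \<sigma> 3 r) < rmem \<sigma> 3 j
           then (1 - P (t r)) * (q r - q j + rmem \<sigma> 3 r) else rmem \<sigma> 3 j)"
          using * s1 J by (auto simp: mem_simps)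
        show "imem \<sigma>3 4 j = (if j \<notin> insert r (?D \<sigma>) \<and>
            \<not> (1 - P (t r)) * (q r - q j + rmem \<sigma> 3 r) < rmem \<sigma> 3 j
           then Suc r else imem \<sigma> 4 j)"
          using * s1 J \<open>j \<le> n\<close> by (auto simp: mem_simps)
      qed (use r P q in auto)
      moreover have "card (insert r (?D \<sigma>)) = Suc k"
        using fin r(3) J(6) by simp
      ultimately have "J (Suc k) (iput 5 0 (Suc k) \<sigma>3)"
        using * s1 J D by (simp add: J_def round_inv_def mem_simps)
      then have "J (Suc k) (iput 5 (ival (INum 0) \<sigma>3) (ival (IAdd (var 5) (INum 1)) \<sigma>3) \<sigma>3)"
        using * s1 J by (simp add: mem_simps)
      then show "runs P (incr 5) \<sigma>3 6 (J (Suc k))"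
        by (rule runs_weaken[OF runs_IPut]) simp
    qed
    then have "runs P (Seq (assign 6 (INum 0)) (Seq relax_loop (incr 5))) (iput 3 r 1 \<sigma>1)
        (3 + ((n * 120 + 180) + 6)) (J (Suc k))"
      by - (rule runs_Seq, rule runs_weaken[OF runs_IPut], simp_all)
    then show ?thesis
      using r(1) by - (rule runs_Seq, rule runs_weaken[OF runs_IPut], simp_all)
  qed
  have "runs P (Seq select_loop (Seq (IPut 3 (var 7) (INum 1))
     (Seq (assign 6 (INum 0)) (Seq relax_loop (incr 5)))))
      ?\<sigma>0 ((n * 60 + 60) + (4 + (3 + ((n * 120 + 180) + 6)))) (J (Suc k))"
  proof (rule runs_Seq, rule runs_mono[OF runs_select_loop order_refl])
    show "imem ?\<sigma>0 6 0 = 0" "imem ?\<sigma>0 7 0 = n" "imem ?\<sigma>0 0 0 = n" "rmem ?\<sigma>0 1 n = 0" "i < n"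
      "imem ?\<sigma>0 3 i = 0" "0 \<le> rmem ?\<sigma>0 1 j" for j
      using J q i by (simp_all add: mem_simps)
  next
    fix \<sigma>1 :: state
    assume "rmem \<sigma>1 = rmem ?\<sigma>0 \<and>
      (\<forall>a. a \<noteq> 6 \<and> a \<noteq> 7 \<longrightarrow> imem \<sigma>1 a = imem ?\<sigma>0 a) \<and>
      (let r = imem \<sigma>1 7 0 in r < n \<and> imem ?\<sigma>0 3 r = 0 \<and>
        (\<forall>j<n. imem ?\<sigma>0 3 j = 0 \<longrightarrow> rmem ?\<sigma>0 1 j \<le> rmem ?\<sigma>0 1 r))"
    then show "runs P (Seq (IPut 3 (var 7) (INum 1)) (Seq (assign 6 (INum 0)) (Seq relax_loop (incr 5))))
        \<sigma>1 (4 + (3 + ((n * 120 + 180) + 6))) (J (Suc k))"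
      using J by (intro relax[OF _ _ refl]) (auto simp: mem_simps Let_def)
  qed
  then have "runs P (Seq (assign 6 (INum 0)) (Seq select_loop (Seq (IPut 3 (var 7) (INum 1))
     (Seq (assign 6 (INum 0)) (Seq relax_loop (incr 5)))))) (iput 7 0 n \<sigma>)
     (3 + ((n * 60 + 60) + (4 + (3 + ((n * 120 + 180) + 6))))) (J (Suc k))"
    by - (rule runs_Seq, rule runs_weaken[OF runs_IPut], simp_all)
  then have "runs P round_body \<sigma> (4 + (3 + ((n * 60 + 60) + (4 + (3 + ((n * 120 + 180) + 6))))))
     (J (Suc k))"
    unfolding round_body_def using J by - (rule runs_Seq, rule runs_weaken[OF runs_IPut], simp_all)
  then show ?thesis
    by (rule runs_weaken) simp
qed

lemma runs_output_loop:
  assumes "path (imem \<sigma> 4) (imem \<sigma> 7 0) s" "imem \<sigma> 1 0 = 0"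
  shows "runs P output_loop \<sigma> (length s * 40 + 40) (\<lambda>\<sigma>'. output_seq \<sigma>' = s)"
proof -
  \<comment> \<open>After \<open>m\<close> outputs the pointer stands at the head of the remaining
    chain.\<close>
  define I where "I m (\<sigma>' :: state) \<longleftrightarrow> imem \<sigma>' 4 = imem \<sigma> 4 \<and> imem \<sigma>' 1 0 = m \<and>
    path (imem \<sigma> 4) (imem \<sigma>' 7 0) (drop m s) \<and> (\<forall>j<m. imem \<sigma>' 2 j = s ! j)" for m \<sigma>'
  show ?thesis
    unfolding output_loop_def
  proof (rule runs_mono[OF runs_While[where I = I and m = "length s" and K = 25]])
    show "I 0 \<sigma>"
      using assms by (simp add: I_def)
  next
    fix j \<sigma>' assume j: "j < length s" and I: "I j \<sigma>'"
    have p: "imem \<sigma>' 7 0 = Suc (s ! j)" "path (imem \<sigma> 4) (imem \<sigma> 4 (s ! j)) (drop (Suc j) s)"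
      using I unfolding I_def Cons_nth_drop_Suc[OF j, symmetric] by simp_all
    show "bval P (ILess (INum 0) (var 7)) \<sigma>'"
      using p by simp
    show "runs P (Seq (IPut 2 (var 1) (ISub (var 7) (INum 1)))
       (Seq (incr 1) (assign 7 (IGet 4 (ISub (var 7) (INum 1)))))) \<sigma>' 25 (I (Suc j))"
      using I p
      by (intro runs_of_wp) (auto simp: I_def mem_simps less_Suc_eq)
  next
    fix \<sigma>' assume "I (length s) \<sigma>'"
    then show "\<not> bval P (ILess (INum 0) (var 7)) \<sigma>'" "output_seq \<sigma>' = s"
      by (auto simp: I_def output_seq_def intro: nth_equalityI)
  qed simp
qed

section \<open>Total running time and optimality of the output\<close>

lemma runs_program:
  fixes t :: "nat \<Rightarrow> nat"
  assumes "n \<ge> 1" and q: "\<forall>r<n. q r \<ge> 0" and "\<beta> > 0"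
  shows "runs (exponential_cdf \<beta>) program (input_state n t q \<beta>) (1000 * n\<^sup>2)
    (\<lambda>\<sigma>. optimal_seq (exponential_cdf \<beta>) t q {..<n} (output_seq \<sigma>))"
proof -
  let ?P = "exponential_cdf \<beta>"
  \<comment> \<open>Extension by zero matches the input memory cell by cell and gives the start
    index \<open>n\<close> quality 0. Sequences over \<open>{..<n}\<close> do not see the
    difference.\<close>
  define t' where "t' r = (if r < n then real (t r) else 0)" for r
  define q' where "q' r = (if r < n then q r else 0)" for r
  define x where "x r = 1 - ?P (t' r)" for r
  have x_eq: "x r = exp (- \<beta> * t' r)" for r
    by (simp add: x_def t'_def exponential_cdf_def)
  have x: "0 \<le> x r" "x r \<le> 1" for r
    using \<open>\<beta> > 0\<close> by (simp_all add: x_eq t'_def)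
  have q': "0 \<le> q' r" "q' n = 0" for r
    using q by (simp_all add: q'_def)
  let ?J = "round_inv ?P n t' q'"
  have optimal: "optimal_seq ?P t q {..<n} s"
    if s: "s \<noteq> []" "set s \<subseteq> {..<n}"
      "\<And>u. set u \<subseteq> {..<n} \<Longrightarrow> gain x q' 0 u \<le> gain x q' 0 s" for s
  proof -
    have "seq_value ?P t q u = gain x q' 0 u" if "u \<noteq> []" "set u \<subseteq> {..<n}" for u
    proof -
      have "seq_value ?P t q u = gain (\<lambda>r. exp (- \<beta> * real (t r))) q 0 u"
        using that q by (intro seq_value_eq_gain) auto
      also have "\<dots> = gain x q' 0 u"
        using that(2) by (intro gain_cong) (auto simp: x_eq t'_def q'_def)
      finally show ?thesis .
    qed
    then show ?thesis
      using s unfolding optimal_seq_def is_arg_max_linorder by (auto simp: in_lists_conv_set subset_iff)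
  qed
  have emit: "runs ?P (Seq (assign 7 (IGet 4 (var 0))) output_loop) \<sigma> (5 + (n * 40 + 40))
      (\<lambda>\<sigma>'. optimal_seq ?P t q {..<n} (output_seq \<sigma>'))" if J: "?J n \<sigma>" for \<sigma>
  proof -
    \<comment> \<open>Having \<open>n\<close> marked rules below \<open>n\<close>, all of them are
      marked.\<close>
    have "{j. imem \<sigma> 3 j \<noteq> 0} = {..<n}"
      using J by (intro card_subset_eq) (auto simp: round_inv_def dp_inv_def)
    then have "dp_inv n x q' {..<n} (rmem \<sigma> 3) (imem \<sigma> 4)"
      using J by (simp add: round_inv_def x_def[abs_def])
    then obtain s where s: "path (imem \<sigma> 4) (imem \<sigma> 4 n) s" "s \<noteq> []" "set s \<subseteq> {..<n}" "length s \<le> n"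
      "\<And>u. set u \<subseteq> {..<n} \<Longrightarrow> gain x q' 0 u \<le> gain x q' 0 s"
      using \<open>n \<ge> 1\<close> x q'(2) by (rule dp_inv_optimal) blast
    let ?\<sigma> = "iput 7 0 (imem \<sigma> 4 n) \<sigma>"
    have "runs ?P output_loop ?\<sigma> (n * 40 + 40) (\<lambda>\<sigma>'. optimal_seq ?P t q {..<n} (output_seq \<sigma>'))"
    proof (rule runs_mono[OF runs_output_loop])
      show "path (imem ?\<sigma> 4) (imem ?\<sigma> 7 0) s" "imem ?\<sigma> 1 0 = 0"
        using s(1) J by (simp_all add: mem_simps round_inv_def)
    qed (use s optimal in auto)
    then show ?thesis
      using J by - (rule runs_Seq, rule runs_weaken[OF runs_IPut], simp_all add: round_inv_def)
  qed
  let ?K = "n * (1 + bcost (ILess (var 5) (var 0)) + (n * 180 + 300))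
    + (1 + bcost (ILess (var 5) (var 0)))"
  have "runs ?P (While (ILess (var 5) (var 0)) round_body) (input_state n t q \<beta>)
     ?K (?J n)"
  proof (rule runs_While[where I = ?J])
    \<comment> \<open>Initially no rule is processed and all gains are 0, witnessed by empty
      chains.\<close>
    show "?J 0 (input_state n t q \<beta>)"
      by (auto simp: round_inv_def input_state_def t'_def q'_def dp_inv_def fun_eq_iff intro!: exI[of _ "[]"])
  next
    fix k \<sigma> assume "k < n" "?J k \<sigma>"
    then show "bval ?P (ILess (var 5) (var 0)) \<sigma>"
      by (simp add: round_inv_def)
    show "runs ?P round_body \<sigma> (n * 180 + 300) (?J (Suc k))"
      by (rule runs_round_body) (use \<open>k < n\<close> \<open>?J k \<sigma>\<close> x q' in \<open>auto simp: round_inv_def x_def\<close>)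
  next
    fix \<sigma> assume "?J n \<sigma>"
    then show "\<not> bval ?P (ILess (var 5) (var 0)) \<sigma>"
      by (simp add: round_inv_def)
  qed
  then have "runs ?P program (input_state n t q \<beta>)
     (?K + (5 + (n * 40 + 40)))
    (\<lambda>\<sigma>. optimal_seq ?P t q {..<n} (output_seq \<sigma>))"
    unfolding program_def by (intro runs_Seq) (rule runs_mono[OF _ order_refl emit])
  then show ?thesis
  proof (rule runs_weaken)
    \<comment> \<open>For \<open>n \<ge> 1\<close> the linear and constant terms are absorbed,
      giving at most 577 times the square of \<open>n\<close>, well below the bound.\<close>
    have "?K + (5 + (n * 40 + 40)) = 180 * n\<^sup>2 + 346 * n + 51"
      by (simp add: power2_eq_square algebra_simps)
    moreover have "n \<le> n\<^sup>2" "1 \<le> n\<^sup>2"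
      using \<open>n \<ge> 1\<close> by (simp_all add: power2_eq_square)
    ultimately show "?K + (5 + (n * 40 + 40)) \<le> 1000 * n\<^sup>2"
      by linarith
  qed
qed

theorem theorem6:
  "\<exists>(c :: com) (T :: nat \<Rightarrow> nat).
     (\<lambda>n. real (T n)) \<in> O(\<lambda>n. (real n)\<^sup>2) \<and>
     (\<forall>(n :: nat) (t :: nat \<Rightarrow> nat) (q :: nat \<Rightarrow> real) (\<beta> :: real).
        n \<ge> 1 \<longrightarrow> (\<forall>r<n. q r \<ge> 0) \<longrightarrow> \<beta> > 0 \<longrightarrow>
        (\<exists>k \<sigma>. exec (exponential_cdf \<beta>) c (input_state n t q \<beta>) k \<sigma> \<and> k \<le> T n \<and>
               optimal_seq (exponential_cdf \<beta>) t q {..<n} (output_seq \<sigma>)))"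
proof (intro exI[of _ program] exI[of _ "\<lambda>n. 1000 * n\<^sup>2"] conjI allI impI)
  show "(\<lambda>n. real (1000 * n\<^sup>2)) \<in> O(\<lambda>n. (real n)\<^sup>2)"
    by (intro bigoI[where c = 1000]) simp
qed (use runs_program in \<open>auto simp: runs_def\<close>)

end
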